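(* Let $n\ge 1$ and let $\lambda\in\mathbb{C}$ be an eigenvalue of a DPP kernel $K\in\mathcal{M}_n(\mathbb{R})$. Then \[\lambda\in \mathcal{B}_{\mathbb{C}}\left(\frac{1}{2}+\frac{1}{2\tan(\pi/n)}\,i,\ \frac{1}{2\sin(\pi/n)}\right)\cup \mathcal{B}_{\mathbb{C}}\left(\frac{1}{2}-\frac{1}{2\tan(\pi/n)}\,i,\ \frac{1}{2\sin(\pi/n)}\right),\] where for $n=2$ one reads $1/\tan(\pi/2)=0$, and for $n=1$ this condition is read as $\lambda\in[0,1]$. In particular, any real eigenvalue of a DPP kernel lies in $[0,1]$.
   Context: $\mathcal{B}_{\mathbb{C}}(x,r)$ is the closed ball (disc) in $\mathbb{C}$ with center $x$ and radius $r$. $[n]=\{1,\dots,n\}$; $\mathcal{M}_n(\mathbb{R})$ is the set of real $n\times n$ matrices. For $S\subset[n]$, $K_S$ is the principal submatrix of $K$ with rows and columns indexed by $S$, with $\det(K_\emptyset)=1$. The determinantal measure with kernel $K$ is the unique signed measure $\mu$ on the power set $\mathcal{P}([n])$ such that $\mu(\{X\in\mathcal{P}([n]): S\subset X\})=\det(K_S)$ for all $S\subset[n]$. $K$ is called a DPP kernel if this $\mu$ is a probability measure. Kernels are not assumed symmetric. *)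

theory Defs
  imports
    "HOL-Probability.Probability_Measure"
    "Jordan_Normal_Form.DL_Submatrix"
    "Jordan_Normal_Form.Char_Poly"
begin

hide_const (open) Determinants.det

text \<open>
  A finite signed measure on the sigma-algebra \<open>M\<close>. As for \<^const>\<open>measure\<close>, the value
  outside \<open>M\<close> is 0 by convention, which makes signed measures with equal values on \<open>M\<close> equal.
\<close>

definition signed_measure :: "'a set \<Rightarrow> 'a set set \<Rightarrow> ('a set \<Rightarrow> real) \<Rightarrow> bool" where
  "signed_measure \<Omega> M \<mu> \<longleftrightarrow>
     sigma_algebra \<Omega> M \<and>
     (\<forall>A :: nat \<Rightarrow> 'a set. range A \<subseteq> M \<longrightarrow> disjoint_family A \<longrightarrow> (\<lambda>i. \<mu> (A i)) sums \<mu> (\<Union>i. A i)) \<and>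
     (\<forall>A. A \<notin> M \<longrightarrow> \<mu> A = 0)"

text \<open>
  Rows and columns of an \<open>n \<times> n\<close> matrix are indexed by \<open>{..<n}\<close> in place of \<open>[n]\<close>. A random subset
  is an outcome in \<open>Pow {..<n}\<close>, so events are elements of \<open>Pow (Pow {..<n})\<close>.
\<close>

definition is_determinantal_measure :: "nat \<Rightarrow> real mat \<Rightarrow> (nat set set \<Rightarrow> real) \<Rightarrow> bool" where
  "is_determinantal_measure n K \<mu> \<longleftrightarrow>
     signed_measure (Pow {..<n}) (Pow (Pow {..<n})) \<mu> \<and>
     (\<forall>S. S \<subseteq> {..<n} \<longrightarrow> \<mu> {X \<in> Pow {..<n}. S \<subseteq> X} = det (submatrix K S S))"

lemma det_submatrix_empty: "det (submatrix K {} {}) = 1"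
  by (simp add: submatrix_def det_dim_zero)

definition determinantal_measure :: "nat \<Rightarrow> real mat \<Rightarrow> nat set set \<Rightarrow> real" where
  "determinantal_measure n K = (THE \<mu>. is_determinantal_measure n K \<mu>)"

definition DPP_kernel :: "nat \<Rightarrow> real mat \<Rightarrow> bool" where
  "DPP_kernel n K \<longleftrightarrow>
     K \<in> carrier_mat n n \<and>
     (\<exists>M. prob_space M \<and> sets M = Pow (Pow {..<n}) \<and> measure M = determinantal_measure n K)"

text \<open>For \<open>n = 2\<close> the centre is \<open>1/2\<close>, because in HOL \<open>x / 0 = 0\<close>:
  \<open>cos (pi / 2) = 0\<close> makes \<open>tan (pi / 2)\<close> and then \<open>1 / (2 * tan (pi / 2))\<close> equal to 0.\<close>

definition eigenvalue_region :: "nat \<Rightarrow> complex set" where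
  "eigenvalue_region n =
     (if n = 1 then complex_of_real ` {0..1}
      else cball (Complex (1/2) (1 / (2 * tan (pi / n)))) (1 / (2 * sin (pi / n))) \<union>
           cball (Complex (1/2) (- (1 / (2 * tan (pi / n))))) (1 / (2 * sin (pi / n))))"

lemma eigenvalue_region_2: "eigenvalue_region 2 = cball (1/2) (1/2)"
  by (simp add: eigenvalue_region_def tan_def complex_eq_iff Complex_eq)

subsection \<open>The determinantal measure exists and is unique\<close>

lemma signed_measure_weights:
  fixes w :: "'a \<Rightarrow> real"
  assumes "finite \<Omega>"
  shows "signed_measure \<Omega> (Pow \<Omega>) (\<lambda>A. if A \<subseteq> \<Omega> then sum w A else 0)"
proof -
  have "(\<lambda>i. sum w (A i)) sums sum w (\<Union>i. A i)"
    if A: "range A \<subseteq> Pow \<Omega>" "disjoint_family A" for A :: "nat \<Rightarrow> 'a set"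
  proof -
    have sum_eq: "sum w B = (\<Sum>x\<in>\<Omega>. if x \<in> B then w x else 0)" if "B \<subseteq> \<Omega>" for B
      using that assms by (simp add: sum.If_cases Int_absorb1 Int_absorb2)
    have "(\<lambda>i. if x \<in> A i then w x else 0) sums (if x \<in> (\<Union>i. A i) then w x else 0)" for x
    proof (cases "x \<in> (\<Union>i. A i)")
      case True
      then obtain j where j: "x \<in> A j" by auto
      then have "x \<in> A i \<longleftrightarrow> i = j" for i
        using A(2) by (auto simp: disjoint_family_on_def)
      then show ?thesis
        using True sums_single[of j "\<lambda>_. w x"] by simp
    qed auto
    then have "(\<lambda>i. \<Sum>x\<in>\<Omega>. if x \<in> A i then w x else 0) sums
               (\<Sum>x\<in>\<Omega>. if x \<in> (\<Union>i. A i) then w x else 0)"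
      by (intro sums_sum)
    moreover have "A i \<subseteq> \<Omega>" "(\<Union>i. A i) \<subseteq> \<Omega>" for i
      using A(1) by auto
    ultimately show ?thesis
      by (simp only: sum_eq)
  qed
  moreover have "(\<Union>i. A i) \<subseteq> \<Omega>" "A i \<subseteq> \<Omega>" if "range A \<subseteq> Pow \<Omega>" for A :: "nat \<Rightarrow> 'a set" and i
    using that by auto
  ultimately show ?thesis
    by (auto simp: signed_measure_def sigma_algebra_Pow)
qed

lemma signed_measure_eq_sum:
  assumes fin: "finite \<Omega>" and \<mu>: "signed_measure \<Omega> (Pow \<Omega>) \<mu>" and A: "A \<subseteq> \<Omega>"
  shows "\<mu> A = (\<Sum>x\<in>A. \<mu> {x})"
proof -
  have ca: "(\<lambda>i. \<mu> (F i)) sums \<mu> (\<Union>i. F i)"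
    if "range F \<subseteq> Pow \<Omega>" "disjoint_family F" for F :: "nat \<Rightarrow> 'a set"
    using \<mu> that by (auto simp: signed_measure_def)
  have "(\<lambda>i::nat. \<mu> {}) sums \<mu> {}"
    using ca[of "\<lambda>_. {}"] by (simp add: disjoint_family_on_def)
  then have empty: "\<mu> {} = 0"
    using sums_summable summable_const_iff by blast
  have finA: "finite A"
    using A fin finite_subset by blast
  then obtain f where f: "bij_betw f {..<card A} A"
    using bij_betw_from_nat_into_finite by blast
  define F where "F i = (if i < card A then {f i} else {})" for i
  have un: "(\<Union>i. F i) = A"
    using f by (force simp: F_def bij_betw_def split: if_splits)
  have "disjoint_family F"
    using f by (auto simp: F_def disjoint_family_on_def bij_betw_def inj_on_def)
  moreover have "range F \<subseteq> Pow \<Omega>"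
    using un A by auto
  ultimately have "(\<lambda>i. \<mu> (F i)) sums \<mu> A"
    using ca[of F] un by simp
  moreover have "(\<lambda>i. \<mu> (F i)) sums (\<Sum>i<card A. \<mu> (F i))"
    by (rule sums_finite) (auto simp: F_def empty)
  ultimately have "\<mu> A = (\<Sum>i<card A. \<mu> (F i))"
    using sums_unique2 by blast
  also have "\<dots> = (\<Sum>i<card A. \<mu> {f i})"
    by (simp add: F_def)
  also have "\<dots> = (\<Sum>x\<in>A. \<mu> {x})"
    using f by (rule sum.reindex_bij_betw)
  finally show ?thesis .
qed

lemma ex1_signed_measure_supersets:
  fixes f :: "'a set \<Rightarrow> real"
  assumes fin: "finite \<Omega>"
  shows "\<exists>!\<mu>. signed_measure (Pow \<Omega>) (Pow (Pow \<Omega>)) \<mu> \<and>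
              (\<forall>S. S \<subseteq> \<Omega> \<longrightarrow> \<mu> {X \<in> Pow \<Omega>. S \<subseteq> X} = f S)"
    (is "\<exists>!\<mu>. ?P \<mu>")
proof (rule ex_ex1I)
  define g where "g U = (\<Sum>T\<in>Pow U. (-1) ^ card T * f (\<Omega> - T))" for U
  define w where "w X = (-1) ^ card (\<Omega> - X) * g (\<Omega> - X)" for X
  have "sum w {X \<in> Pow \<Omega>. S \<subseteq> X} = f S" if S: "S \<subseteq> \<Omega>" for S
  proof -
    have "f (\<Omega> - (\<Omega> - S)) = (\<Sum>T\<in>Pow (\<Omega> - S). (-1) ^ card T * g T)"
      by (rule inclusion_exclusion_symmetric) (simp_all add: g_def fin)
    also have "\<dots> = sum w {X \<in> Pow \<Omega>. S \<subseteq> X}"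
      unfolding w_def
      by (rule sum.reindex_bij_witness[of _ "\<lambda>X. \<Omega> - X" "\<lambda>X. \<Omega> - X"])
         (use S in \<open>auto simp: double_diff[OF subset_trans[OF _ Diff_subset] subset_refl]\<close>)
    finally show ?thesis
      using S by (simp add: double_diff)
  qed
  moreover have "signed_measure (Pow \<Omega>) (Pow (Pow \<Omega>)) (\<lambda>A. if A \<subseteq> Pow \<Omega> then sum w A else 0)"
    using fin by (intro signed_measure_weights) simp
  moreover have "{X \<in> Pow \<Omega>. S \<subseteq> X} \<subseteq> Pow \<Omega>" for S
    by auto
  ultimately show "\<exists>\<mu>. ?P \<mu>"
    by (intro exI[of _ "\<lambda>A. if A \<subseteq> Pow \<Omega> then sum w A else 0"]) simp
next
  fix \<mu> \<nu>
  assume \<mu>: "?P \<mu>" and \<nu>: "?P \<nu>"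
  have \<mu>_sum: "\<mu> A = (\<Sum>X\<in>A. \<mu> {X})" and \<nu>_sum: "\<nu> A = (\<Sum>X\<in>A. \<nu> {X})"
    if "A \<subseteq> Pow \<Omega>" for A
    using that fin \<mu> \<nu> by (auto intro: signed_measure_eq_sum[of "Pow \<Omega>"])
  have singletons: "\<mu> {X} = \<nu> {X}" if "X \<subseteq> \<Omega>" for X
    using that
  proof (induction "card (\<Omega> - X)" arbitrary: X rule: less_induct)
    case less
    let ?B = "{Y \<in> Pow \<Omega>. X \<subset> Y}"
    have split: "{Y \<in> Pow \<Omega>. X \<subseteq> Y} = insert X ?B" "X \<notin> ?B" "finite ?B"
      using less.prems fin by auto
    have "\<mu> {Y} = \<nu> {Y}" if "Y \<in> ?B" for Y
    proof (rule less.hyps)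
      show "card (\<Omega> - Y) < card (\<Omega> - X)"
        using that fin by (intro psubset_card_mono) auto
    qed (use that in auto)
    then have eq: "(\<Sum>Y\<in>?B. \<mu> {Y}) = (\<Sum>Y\<in>?B. \<nu> {Y})"
      by (intro sum.cong) auto
    have sub: "insert X ?B \<subseteq> Pow \<Omega>"
      using less.prems by auto
    have "\<mu> (insert X ?B) = f X" "\<nu> (insert X ?B) = f X"
      using \<mu> \<nu> less.prems unfolding split(1)[symmetric] by blast+
    then have "(\<Sum>Y\<in>insert X ?B. \<mu> {Y}) = (\<Sum>Y\<in>insert X ?B. \<nu> {Y})"
      unfolding \<mu>_sum[OF sub] \<nu>_sum[OF sub] by simp
    then show ?case
      using split(2,3) eq by simp
  qed
  show "\<mu> = \<nu>"
  proof
    fix A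
    show "\<mu> A = \<nu> A"
    proof (cases "A \<subseteq> Pow \<Omega>")
      case True
      have "(\<Sum>X\<in>A. \<mu> {X}) = (\<Sum>X\<in>A. \<nu> {X})"
        using True singletons by (intro sum.cong) auto
      with True show ?thesis
        by (simp add: \<mu>_sum \<nu>_sum)
    next
      case False
      with \<mu> \<nu> show ?thesis
        by (simp add: signed_measure_def)
    qed
  qed
qed

lemma ex1_determinantal_measure: "\<exists>!\<mu>. is_determinantal_measure n K \<mu>"
  unfolding is_determinantal_measure_def by (rule ex1_signed_measure_supersets) simp

lemma is_determinantal_measure_determinantal_measure:
  "is_determinantal_measure n K (determinantal_measure n K)"
  unfolding determinantal_measure_def using ex1_determinantal_measure by (rule theI')

end

theory Submission
  imports Defs
begin

text \<open>
  Let \<open>X\<close> be a random set with law \<open>\<mu>\<close>, the determinantal measure with kernel \<open>K\<close>. The prescribed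
  values \<open>\<mu> {X. S \<subseteq> X} = det K\<^sub>S\<close> are, up to the factors \<open>s ^ card S\<close>, the terms of the expansion of
  \<open>det (1 + s K)\<close> in principal minors (\<open>det_one_plus_smult\<close>). Summing them up and exchanging the sums
  over \<open>S\<close> and \<open>X\<close> identifies the probability generating function of the size of \<open>X\<close>:
  \<open>det (1 + (t - 1) K) = E (t ^ card X)\<close>, for complex \<open>t\<close> (\<open>DPP_kernel_generating_function\<close>).

  The right-hand side is a nonzero polynomial in \<open>t\<close> of degree at most \<open>n\<close> with nonnegative
  coefficients, because \<open>\<mu>\<close> is a probability measure. Such a polynomial has no root \<open>t \<noteq> 0\<close> with
  \<open>\<bar>Arg t\<bar> < \<pi> / n\<close>: the powers \<open>1, t, \<dots>, t ^ n\<close> would lie in a sector of opening less than \<open>\<pi>\<close>, hence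
  in an open half-plane whose boundary passes through 0 (\<open>root_Arg_ge_of_nonneg_coeffs\<close>).

  An eigenvalue \<open>z \<noteq> 0\<close> of \<open>K\<close> makes \<open>1 - K / z\<close> singular, so that \<open>t = 1 - 1 / z = (z - 1) / z\<close> is a
  root. Since \<open>\<bar>Arg t\<bar>\<close> is the angle under which the segment from 0 to 1 is seen from \<open>z\<close>, the
  condition \<open>\<bar>Arg t\<bar> \<ge> \<pi> / n\<close> describes for \<open>n \<ge> 2\<close>, by the inscribed angle theorem, two discs with that
  segment as a common chord; these are the two discs of the statement (\<open>eigenvalue_region_if_Arg\<close>). If
  \<open>z\<close> is real then so is \<open>t\<close>, which is not positive, and \<open>t \<le> 0\<close> means \<open>0 < z \<le> 1\<close>. For \<open>n = 1\<close> the condition \<open>\<bar>Arg t\<bar> \<ge> \<pi>\<close> forces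
  \<open>t\<close> to be a negative real.
\<close>

section \<open>Principal minors and the generating function of the size\<close>

lemma bij_betw_pick:
  assumes "finite S"
  shows "bij_betw (pick S) {..<card S} S"
proof -
  have "inj_on (pick S) {..<card S}"
    by (auto intro!: strict_mono_on_imp_inj_on strict_mono_onI pick_mono_le)
  moreover have "pick S ` {..<card S} \<subseteq> S"
    by (auto intro: pick_in_set_le)
  ultimately show ?thesis
    using assms by (simp add: bij_betw_def card_image card_subset_eq)
qed

text \<open>
  Renumbering \<open>S\<close> increasingly by \<open>{..<card S}\<close> conjugates permutations of one set into permutations of
  the other and preserves their signs. So a principal minor has a Leibniz formula in which the
  original row indices are kept, which allows minors for different \<open>S\<close> to be added up.
\<close>

lemma det_principal_submatrix:
  fixes A :: "'a :: comm_ring_1 mat"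
  assumes A: "A \<in> carrier_mat n n" and S: "S \<subseteq> {..<n}"
  shows "det (submatrix A S S) = (\<Sum>p | p permutes S. signof p * (\<Prod>i\<in>S. A $$ (i, p i)))"
proof -
  let ?m = "card S" and ?f = "pick S"
  let ?\<Phi> = "map_permutation {..<?m} ?f"
  have fin: "finite S"
    using S finite_subset by blast
  have f: "bij_betw ?f {..<?m} S"
    using fin by (rule bij_betw_pick)
  have inj: "inj_on ?f {..<?m}"
    using f by (rule bij_betw_imp_inj_on)
  have eq: "{i. i < n \<and> i \<in> S} = S"
    using S by auto
  have sub: "submatrix A S S = mat ?m ?m (\<lambda>(i, j). A $$ (?f i, ?f j))"
    using A by (simp add: submatrix_def eq)
  have "?\<Phi> = (\<lambda>p x. if x \<in> S then ?f (p (inv_into {..<?m} ?f x)) else x)"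
    using f by (auto simp: map_permutation_def restrict_id_def bij_betw_def fun_eq_iff)
  then have \<Phi>: "bij_betw ?\<Phi> {p. p permutes {..<?m}} {p. p permutes S}"
    using bij_betw_permutations[OF f] by simp
  have "det (submatrix A S S)
      = (\<Sum>p | p permutes {..<?m}. signof p * (\<Prod>i<?m. submatrix A S S $$ (i, p i)))"
    by (simp add: det_def'[of _ ?m] sub atLeast0LessThan)
  also have "\<dots> = (\<Sum>p | p permutes {..<?m}. signof (?\<Phi> p) * (\<Prod>i\<in>S. A $$ (i, ?\<Phi> p i)))"
  proof (intro sum.cong refl)
    fix p assume "p \<in> {p. p permutes {..<?m}}"
    then have p: "p permutes {..<?m}" by simp
    have "(\<Prod>i<?m. submatrix A S S $$ (i, p i)) = (\<Prod>i<?m. A $$ (?f i, ?\<Phi> p (?f i)))"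
      using permutes_in_image[OF p] by (intro prod.cong) (auto simp: sub map_permutation_apply[OF inj])
    also have "\<dots> = (\<Prod>i\<in>S. A $$ (i, ?\<Phi> p i))"
      using f by (rule prod.reindex_bij_betw)
    finally show "signof p * (\<Prod>i<?m. submatrix A S S $$ (i, p i))
        = signof (?\<Phi> p) * (\<Prod>i\<in>S. A $$ (i, ?\<Phi> p i))"
      by (simp add: sign_map_permutation[OF inj p])
  qed
  also have "\<dots> = (\<Sum>p | p permutes S. signof p * (\<Prod>i\<in>S. A $$ (i, p i)))"
    using \<Phi> by (rule sum.reindex_bij_betw)
  finally show ?thesis .
qed

text \<open>
  In the Leibniz formula, expand each product of \<open>\<delta> i (p i) + s * A $$ (i, p i)\<close> over the set \<open>S\<close> of
  those \<open>i\<close> for which the second summand is chosen. The Kronecker deltas left over say that \<open>p\<close> fixes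
  the complement of \<open>S\<close>, so that only permutations of \<open>S\<close> survive and form the minor of \<open>S\<close>.
\<close>

lemma det_one_plus_smult:
  fixes A :: "'a :: comm_ring_1 mat"
  assumes A: "A \<in> carrier_mat n n"
  shows "det (1\<^sub>m n + s \<cdot>\<^sub>m A) = (\<Sum>S\<in>Pow {..<n}. s ^ card S * det (submatrix A S S))"
proof -
  let ?N = "{..<n}"
  let ?a = "\<lambda>p S. \<Prod>i\<in>S. A $$ (i, p i)"
  have expand: "(\<Prod>i<n. (1\<^sub>m n + s \<cdot>\<^sub>m A) $$ (i, p i))
      = (\<Sum>S\<in>Pow ?N. if p permutes S then s ^ card S * ?a p S else 0)"
    if p: "p permutes ?N" for p
  proof -
    have "(\<Prod>i<n. (1\<^sub>m n + s \<cdot>\<^sub>m A) $$ (i, p i))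
        = (\<Prod>i<n. s * A $$ (i, p i) + (if p i = i then 1 else 0))"
      using A permutes_in_image[OF p] by (intro prod.cong) (auto simp: add.commute)
    also have "\<dots> = (\<Sum>S\<in>Pow ?N. (\<Prod>i\<in>S. s * A $$ (i, p i)) * (\<Prod>i\<in>?N - S. if p i = i then 1 else 0))"
      by (rule prod_add) simp
    also have "\<dots> = (\<Sum>S\<in>Pow ?N. if p permutes S then s ^ card S * ?a p S else 0)"
    proof (intro sum.cong refl)
      fix S assume S: "S \<in> Pow ?N"
      have "p permutes S \<longleftrightarrow> (\<forall>i\<in>?N - S. p i = i)"
        using p by (auto intro: permutes_superset simp: permutes_not_in)
      moreover have "(\<Prod>i\<in>?N - S. if p i = i then 1 else 0 :: 'a) = (if \<forall>i\<in>?N - S. p i = i then 1 else 0)"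
        by (auto intro!: prod.neutral prod_zero)
      ultimately show "(\<Prod>i\<in>S. s * A $$ (i, p i)) * (\<Prod>i\<in>?N - S. if p i = i then 1 else 0)
          = (if p permutes S then s ^ card S * ?a p S else 0)"
        by (simp add: prod.distrib)
    qed
    finally show ?thesis .
  qed
  have "det (1\<^sub>m n + s \<cdot>\<^sub>m A)
      = (\<Sum>p | p permutes ?N. signof p * (\<Prod>i<n. (1\<^sub>m n + s \<cdot>\<^sub>m A) $$ (i, p i)))"
    using A by (simp add: det_def'[of _ n] atLeast0LessThan)
  also have "\<dots> = (\<Sum>p | p permutes ?N. \<Sum>S\<in>Pow ?N.
      if p permutes S then s ^ card S * (signof p * ?a p S) else 0)"
    by (auto simp: expand sum_distrib_left intro!: sum.cong)
  also have "\<dots> = (\<Sum>S\<in>Pow ?N. \<Sum>p | p permutes ?N.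
      if p permutes S then s ^ card S * (signof p * ?a p S) else 0)"
    by (rule sum.swap)
  also have "\<dots> = (\<Sum>S\<in>Pow ?N. \<Sum>p | p permutes S. s ^ card S * (signof p * ?a p S))"
    by (intro sum.cong refl sum.mono_neutral_cong_right)
       (auto simp: finite_permutations intro: permutes_subset)
  also have "\<dots> = (\<Sum>S\<in>Pow ?N. s ^ card S * det (submatrix A S S))"
    by (intro sum.cong refl) (simp add: det_principal_submatrix[OF A] sum_distrib_left)
  finally show ?thesis .
qed

text \<open>
  For fixed \<open>X\<close>, the powers \<open>s ^ card S\<close> over the subsets \<open>S\<close> of \<open>X\<close> add up to \<open>(1 + s) ^ card X\<close> by the
  binomial theorem. With \<open>w\<close> a probability this expresses the generating function of the size of a
  random set by its factorial moments.
\<close>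

lemma sum_power_card_supersets:
  fixes s :: "'a :: comm_ring_1" and w :: "'b set \<Rightarrow> 'a"
  assumes "finite \<Omega>"
  shows "(\<Sum>S\<in>Pow \<Omega>. s ^ card S * sum w {X \<in> Pow \<Omega>. S \<subseteq> X})
      = (\<Sum>X\<in>Pow \<Omega>. w X * (1 + s) ^ card X)"
proof -
  have binomial: "(\<Sum>S\<in>Pow X. s ^ card S) = (1 + s) ^ card X" if "X \<in> Pow \<Omega>" for X
    using prod_add[of X "\<lambda>_. s" "\<lambda>_. 1"] that assms finite_subset[of X \<Omega>]
    by (simp add: add.commute)
  have "(\<Sum>S\<in>Pow \<Omega>. s ^ card S * sum w {X \<in> Pow \<Omega>. S \<subseteq> X})
      = (\<Sum>S\<in>Pow \<Omega>. \<Sum>X\<in>{X \<in> Pow \<Omega>. S \<subseteq> X}. s ^ card S * w X)"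
    by (simp add: sum_distrib_left)
  also have "\<dots> = (\<Sum>X\<in>Pow \<Omega>. \<Sum>S\<in>{S \<in> Pow \<Omega>. S \<subseteq> X}. s ^ card S * w X)"
    using assms by (intro sum.swap_restrict) auto
  also have "\<dots> = (\<Sum>X\<in>Pow \<Omega>. w X * (\<Sum>S\<in>Pow X. s ^ card S))"
    by (auto simp: sum_distrib_left mult.commute intro!: sum.cong)
  also have "\<dots> = (\<Sum>X\<in>Pow \<Omega>. w X * (1 + s) ^ card X)"
    by (simp add: binomial)
  finally show ?thesis .
qed

text \<open>
  Here \<open>w X\<close> is the probability of the outcome \<open>X\<close>, and \<open>1 + s\<close> is the argument of the generating
  function. Complex \<open>s\<close> is needed because eigenvalues of \<open>K\<close> need not be real.
\<close>

lemma DPP_kernel_generating_function: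
  assumes K: "DPP_kernel n K"
  obtains w :: "nat set \<Rightarrow> real"
  where "\<And>X. w X \<ge> 0" and "sum w (Pow {..<n}) = 1"
    and "\<And>s :: complex. det (1\<^sub>m n + s \<cdot>\<^sub>m map_mat complex_of_real K)
           = (\<Sum>X\<in>Pow {..<n}. w X * (1 + s) ^ card X)"
proof -
  let ?N = "{..<n}" and ?\<mu> = "determinantal_measure n K" and ?K = "map_mat complex_of_real K"
  obtain M where Kn: "K \<in> carrier_mat n n" and M: "prob_space M"
    and sets: "sets M = Pow (Pow ?N)" and \<mu>: "measure M = ?\<mu>"
    using K unfolding DPP_kernel_def by blast
  have det_\<mu>: "is_determinantal_measure n K ?\<mu>"
    by (rule is_determinantal_measure_determinantal_measure)
  have \<mu>_sum: "?\<mu> B = (\<Sum>X\<in>B. ?\<mu> {X})" if "B \<subseteq> Pow ?N" for B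
    using det_\<mu> that unfolding is_determinantal_measure_def
    by (intro signed_measure_eq_sum[of "Pow ?N"]) auto
  have space: "space M = Pow ?N"
    using sets.top[of M] sets.sets_into_space[of "Pow ?N" M] sets by auto
  show thesis
  proof
    show "?\<mu> {X} \<ge> 0" for X
      by (simp add: measure_nonneg flip: \<mu>)
    have "?\<mu> (Pow ?N) = 1"
      using prob_space.prob_space[OF M] by (simp add: space \<mu>)
    then show "(\<Sum>X\<in>Pow ?N. ?\<mu> {X}) = 1"
      using \<mu>_sum[of "Pow ?N"] by simp
    fix s :: complex
    have minor: "det (submatrix ?K S S) = (\<Sum>X\<in>{X \<in> Pow ?N. S \<subseteq> X}. complex_of_real (?\<mu> {X}))"
      if "S \<in> Pow ?N" for S
    proof -
      have "submatrix ?K S S = map_mat complex_of_real (submatrix K S S)"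
        using Kn by (intro eq_matI) (auto simp: submatrix_def pick_le)
      then have "det (submatrix ?K S S) = of_real (det (submatrix K S S))"
        by (simp only: of_real_hom.hom_det)
      also have "det (submatrix K S S) = ?\<mu> {X \<in> Pow ?N. S \<subseteq> X}"
        using det_\<mu> that by (simp add: is_determinantal_measure_def)
      also have "\<dots> = (\<Sum>X\<in>{X \<in> Pow ?N. S \<subseteq> X}. ?\<mu> {X})"
        by (rule \<mu>_sum) auto
      finally show ?thesis by simp
    qed
    have "det (1\<^sub>m n + s \<cdot>\<^sub>m ?K) = (\<Sum>S\<in>Pow ?N. s ^ card S * det (submatrix ?K S S))"
      using Kn by (intro det_one_plus_smult) simp
    also have "\<dots> = (\<Sum>S\<in>Pow ?N. s ^ card S * (\<Sum>X\<in>{X \<in> Pow ?N. S \<subseteq> X}. complex_of_real (?\<mu> {X})))"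
      using minor by (intro sum.cong) auto
    also have "\<dots> = (\<Sum>X\<in>Pow ?N. ?\<mu> {X} * (1 + s) ^ card X)"
      by (rule sum_power_card_supersets) simp
    finally show "det (1\<^sub>m n + s \<cdot>\<^sub>m ?K) = (\<Sum>X\<in>Pow ?N. ?\<mu> {X} * (1 + s) ^ card X)" .
  qed
qed

section \<open>Roots of polynomials with nonnegative coefficients\<close>

text \<open>
  If \<open>t\<close> had a smaller argument, then \<open>t ^ 0, \<dots>, t ^ n\<close> would have arguments between 0 and \<open>n * Arg t\<close>,
  a range of length less than \<open>\<pi>\<close>. Rotating the middle \<open>n * Arg t / 2\<close> of this range to 0 gives every
  power a positive real part, so that the sum cannot vanish unless all weights do. Centring the
  sector treats both signs of \<open>Arg t\<close>, and positive reals, alike.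
\<close>

lemma root_Arg_ge_of_nonneg_coeffs:
  fixes w :: "'i \<Rightarrow> real" and e :: "'i \<Rightarrow> nat" and t :: complex
  assumes n: "n \<ge> 1" and e: "\<And>i. i \<in> I \<Longrightarrow> e i \<le> n"
    and w: "\<And>i. i \<in> I \<Longrightarrow> w i \<ge> 0" and nonzero: "sum w I \<noteq> 0"
    and t: "t \<noteq> 0" and root: "(\<Sum>i\<in>I. w i * t ^ e i) = 0"
  shows "pi / n \<le> \<bar>Arg t\<bar>"
proof (rule ccontr)
  assume "\<not> pi / n \<le> \<bar>Arg t\<bar>"
  then have small: "n * \<bar>Arg t\<bar> < pi"
    using n by (simp add: field_simps)
  have fin: "finite I"
    using nonzero sum.infinite by blast
  define u where "u = cis (- (n / 2 * Arg t))"
  have pos: "Re (t ^ k * u) > 0" if "k \<le> n" for k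
  proof -
    have "\<bar>real k - n / 2\<bar> \<le> n / 2"
      using that unfolding abs_le_iff by (simp add: field_simps)
    then have "\<bar>real k - n / 2\<bar> * \<bar>Arg t\<bar> \<le> n / 2 * \<bar>Arg t\<bar>"
      by (rule mult_right_mono) simp
    then have "\<bar>(real k - n / 2) * Arg t\<bar> < pi / 2"
      using small by (simp add: abs_mult)
    then have "cos ((real k - n / 2) * Arg t) > 0"
      by (intro cos_gt_zero_pi) (auto simp: abs_less_iff)
    moreover have "t ^ k * u = norm t ^ k * cis ((real k - n / 2) * Arg t)"
    proof -
      have "t ^ k = (norm t * cis (Arg t)) ^ k"
        using rcis_cmod_Arg[of t] by (simp add: rcis_def)
      also have "\<dots> = norm t ^ k * cis (k * Arg t)"
        by (simp only: power_mult_distrib Complex.DeMoivre of_real_power)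
      finally show ?thesis
        by (simp add: u_def cis_mult algebra_simps)
    qed
    ultimately show ?thesis
      using t by (simp flip: of_real_power)
  qed
  have "(\<Sum>i\<in>I. w i * Re (t ^ e i * u)) = Re ((\<Sum>i\<in>I. w i * t ^ e i) * u)"
    by (simp only: sum_distrib_right Re_sum mult.assoc Re_complex_of_real times_complex.sel Im_complex_of_real) simp
  also have "\<dots> = 0"
    by (simp add: root)
  finally have "(\<Sum>i\<in>I. w i * Re (t ^ e i * u)) = 0" .
  moreover have "w i * Re (t ^ e i * u) \<ge> 0" if "i \<in> I" for i
    using w[OF that] pos[OF e[OF that]] by simp
  ultimately have "\<forall>i\<in>I. w i * Re (t ^ e i * u) = 0"
    by (simp add: sum_nonneg_eq_0_iff[OF fin])
  then have "\<forall>i\<in>I. w i = 0"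
    using pos e by fastforce
  then show False
    using nonzero by simp
qed

section \<open>The two discs as a condition on the viewing angle\<close>

text \<open>
  By \<open>1 + (cot \<alpha>)\<^sup>2 = 1 / (sin \<alpha>)\<^sup>2\<close> the constant terms in the equations of both circles cancel, which
  expresses that the circles pass through 0 and 1. The two discs then differ only in the sign of
  \<open>Im z\<close>, and as \<open>cos \<alpha> \<ge> 0\<close> the weaker of the two conditions is the one with \<open>\<bar>Im z\<bar>\<close>.
\<close>

lemma mem_eigenvalue_region_iff:
  assumes n: "n \<ge> 2"
  shows "z \<in> eigenvalue_region n \<longleftrightarrow>
     ((cmod z)\<^sup>2 - Re z) * sin (pi / n) \<le> \<bar>Im z\<bar> * cos (pi / n)"
proof -
  define \<alpha> where "\<alpha> = pi / n"
  have \<alpha>: "0 < \<alpha>" "\<alpha> \<le> pi / 2"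
    using n by (auto simp: \<alpha>_def field_simps)
  have s: "sin \<alpha> > 0" and c: "cos \<alpha> \<ge> 0"
    using \<alpha> by (auto intro!: sin_gt_zero cos_ge_zero)
  \<comment> \<open>The sign \<open>\<sigma>\<close> selects the disc: \<open>1\<close> for the upper and \<open>-1\<close> for the lower one.\<close>
  have disc: "z \<in> cball (Complex (1/2) (1 / (2 * tan \<alpha>) * \<sigma>)) (1 / (2 * sin \<alpha>)) \<longleftrightarrow>
      ((cmod z)\<^sup>2 - Re z) * sin \<alpha> \<le> \<sigma> * Im z * cos \<alpha>" if \<sigma>: "\<sigma>\<^sup>2 = 1" for \<sigma> :: real
  proof -
    let ?b = "cos \<alpha> / (2 * sin \<alpha>) * \<sigma>"
    have "z \<in> cball (Complex (1/2) (1 / (2 * tan \<alpha>) * \<sigma>)) (1 / (2 * sin \<alpha>)) \<longleftrightarrow>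
        (cmod (Complex (1/2) ?b - z))\<^sup>2 \<le> (1 / (2 * sin \<alpha>))\<^sup>2"
      using s by (subst power_mono_iff) (auto simp: dist_norm tan_def)
    also have "(cmod (Complex (1/2) ?b - z))\<^sup>2 =
        (cmod z)\<^sup>2 - Re z - \<sigma> * Im z * cos \<alpha> / sin \<alpha> + (1/4 + (cos \<alpha> / (2 * sin \<alpha>))\<^sup>2)"
      using \<sigma> by (simp add: cmod_power2 power2_diff power_mult_distrib power_divide algebra_simps)
    also have "1/4 + (cos \<alpha> / (2 * sin \<alpha>))\<^sup>2 = (1 / (2 * sin \<alpha>))\<^sup>2"
      using s by (simp add: field_simps)
    also have "(cmod z)\<^sup>2 - Re z - \<sigma> * Im z * cos \<alpha> / sin \<alpha> + (1 / (2 * sin \<alpha>))\<^sup>2 \<le> (1 / (2 * sin \<alpha>))\<^sup>2 \<longleftrightarrow>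
        ((cmod z)\<^sup>2 - Re z) * sin \<alpha> \<le> \<sigma> * Im z * cos \<alpha>"
      using pos_le_divide_eq[OF s, of "(cmod z)\<^sup>2 - Re z" "\<sigma> * Im z * cos \<alpha>"] by linarith
    finally show ?thesis .
  qed
  have "\<bar>Im z\<bar> * cos \<alpha> = max (Im z * cos \<alpha>) (- Im z * cos \<alpha>)"
    using c by (auto simp: max_def abs_if mult_le_0_iff zero_le_mult_iff)
  then show ?thesis
    using disc[of 1] disc[of "-1"] n by (auto simp: eigenvalue_region_def \<alpha>_def)
qed

text \<open>
  Multiplying \<open>t = 1 - 1 / z\<close> by \<open>(cmod z)\<^sup>2 > 0\<close> keeps its argument and gives \<open>(cmod z)\<^sup>2 - cnj z\<close>, with real
  part \<open>(cmod z)\<^sup>2 - Re z\<close> and imaginary part \<open>Im z\<close>: exactly the quantities that describe the region. In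
  polar coordinates of \<open>t\<close>, being outside the region reads \<open>sin (\<bar>Arg t\<bar> - \<pi> / n) < 0\<close>, whereas
  \<open>\<bar>Arg t\<bar> - \<pi> / n\<close> lies between 0 and \<open>\<pi>\<close>.
\<close>

lemma eigenvalue_region_if_Arg:
  assumes n: "n \<ge> 2" and z: "z \<noteq> 0" and arg: "pi / n \<le> \<bar>Arg (1 - 1 / z)\<bar>"
  shows "z \<in> eigenvalue_region n"
proof (rule ccontr)
  define \<alpha> t where "\<alpha> = pi / n" and "t = 1 - 1 / z"
  define \<theta> where "\<theta> = \<bar>Arg t\<bar>"
  assume "z \<notin> eigenvalue_region n"
  then have out: "\<bar>Im z\<bar> * cos \<alpha> < ((cmod z)\<^sup>2 - Re z) * sin \<alpha>"
    using n by (simp add: mem_eigenvalue_region_iff \<alpha>_def)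
  have \<alpha>: "0 < \<alpha>" "\<alpha> \<le> pi / 2" "\<alpha> \<le> \<theta>" "\<theta> \<le> pi"
    using n arg Arg_bounded[of t] by (auto simp: \<alpha>_def \<theta>_def t_def field_simps)
  have "(cmod z)\<^sup>2 * t = (cmod z)\<^sup>2 - cnj z"
    using z by (simp add: t_def algebra_simps complex_norm_square flip: of_real_power)
  then have "Re ((cmod z)\<^sup>2 * t) = (cmod z)\<^sup>2 - Re z" "Im ((cmod z)\<^sup>2 * t) = Im z"
    by (simp_all flip: of_real_power)
  then have "\<bar>(cmod z)\<^sup>2 * Im t\<bar> * cos \<alpha> < (cmod z)\<^sup>2 * Re t * sin \<alpha>"
    using out by (simp flip: of_real_power)
  then have "(cmod z)\<^sup>2 * (\<bar>Im t\<bar> * cos \<alpha>) < (cmod z)\<^sup>2 * (Re t * sin \<alpha>)"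
    by (simp add: abs_mult mult.assoc)
  then have "\<bar>Im t\<bar> * cos \<alpha> < Re t * sin \<alpha>"
    using z by simp
  moreover have "Re t = cmod t * cos \<theta>" "\<bar>Im t\<bar> = cmod t * sin \<theta>"
  proof -
    have "Re t = cmod t * cos (Arg t)" "Im t = cmod t * sin (Arg t)"
      using Re_rcis[of "cmod t" "Arg t"] Im_rcis[of "cmod t" "Arg t"] by (simp_all add: rcis_cmod_Arg)
    moreover have "\<bar>sin (Arg t)\<bar> = sin \<theta>"
      using \<alpha> sin_ge_zero[of \<theta>] by (auto simp: \<theta>_def abs_if split: if_splits)
    moreover have "cos \<theta> = cos (Arg t)"
      by (simp add: \<theta>_def)
    ultimately show "Re t = cmod t * cos \<theta>" "\<bar>Im t\<bar> = cmod t * sin \<theta>"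
      by (simp_all add: abs_mult)
  qed
  ultimately have "cmod t * (sin \<theta> * cos \<alpha>) < cmod t * (cos \<theta> * sin \<alpha>)"
    by (simp add: mult.assoc)
  then have "sin (\<theta> - \<alpha>) < 0"
    by (simp add: sin_diff mult_less_cancel_left)
  moreover have "sin (\<theta> - \<alpha>) \<ge> 0"
    using \<alpha> by (intro sin_ge_zero) auto
  ultimately show False by simp
qed

lemma real_interval_if_one_minus_inverse_nonpos:
  assumes z: "z \<noteq> 0" and real: "1 - 1 / z \<in> \<real>" and Re: "Re (1 - 1 / z) \<le> 0"
  shows "z \<in> complex_of_real ` {0..1}"
proof -
  obtain r where "1 - 1 / z = complex_of_real r"
    using real by (auto elim: Reals_cases)
  then have "r \<le> 0" and "1 / z = complex_of_real (1 - r)"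
    using Re by (simp_all, simp add: algebra_simps)
  then have "z = complex_of_real (1 / (1 - r))"
    by (metis div_by_1 divide_divide_eq_right mult_1 of_real_1 of_real_divide)
  moreover have "1 / (1 - r) \<in> {0..1}"
    using \<open>r \<le> 0\<close> by (simp add: field_simps)
  ultimately show ?thesis by blast
qed

theorem proposition2p6:
  fixes n :: nat and K :: "real mat" and z :: complex
  assumes "n \<ge> 1"
    and "DPP_kernel n K"
    and "eigenvalue (map_mat complex_of_real K) z"
  shows "z \<in> eigenvalue_region n \<and> (z \<in> \<real> \<longrightarrow> z \<in> complex_of_real ` {0..1})"
proof (cases "z = 0 \<or> z = 1")
  \<comment> \<open>The substitution \<open>t = 1 - 1 / z\<close> has no value at \<open>z = 0\<close>, and \<open>z = 1\<close> gives \<open>t = 0\<close>, which has no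
    argument. For \<open>n \<ge> 2\<close> both circles pass through 0 and 1.\<close>
  case True
  then have "z \<in> complex_of_real ` {0..1}"
    by (auto intro: image_eqI[of _ _ 0] image_eqI[of _ _ 1])
  moreover from True have "z \<in> eigenvalue_region n" if "n \<ge> 2"
    using that sin_ge_zero[of "pi / n"] by (auto simp: mem_eigenvalue_region_iff)
  moreover have "eigenvalue_region 1 = complex_of_real ` {0..1}"
    by (simp add: eigenvalue_region_def)
  moreover have "n = 1 \<or> n \<ge> 2"
    using assms(1) by auto
  ultimately show ?thesis by auto
next
  case False
  define t where "t = 1 - 1 / z"
  have z: "z \<noteq> 0" and t: "t \<noteq> 0"
    using False by (auto simp: t_def)
  let ?K = "map_mat complex_of_real K"
  obtain w :: "nat set \<Rightarrow> real" where w: "\<And>X. w X \<ge> 0" "sum w (Pow {..<n}) = 1"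
    and gf: "\<And>s :: complex. det (1\<^sub>m n + s \<cdot>\<^sub>m ?K) = (\<Sum>X\<in>Pow {..<n}. w X * (1 + s) ^ card X)"
    using DPP_kernel_generating_function[OF assms(2)] by blast
  have K: "?K \<in> carrier_mat n n"
    using assms(2) by (simp add: DPP_kernel_def)
  have "1\<^sub>m n + (- 1 / z) \<cdot>\<^sub>m ?K = (- 1 / z) \<cdot>\<^sub>m char_matrix ?K z"
    using K z by (intro eq_matI) (auto simp: char_matrix_def field_simps)
  then have "det (1\<^sub>m n + (- 1 / z) \<cdot>\<^sub>m ?K) = 0"
    using assms(3) by (simp add: eigenvalue_det[OF K])
  then have root: "(\<Sum>X\<in>Pow {..<n}. w X * t ^ card X) = 0"
    by (simp add: gf t_def)
  have arg: "pi / n \<le> \<bar>Arg t\<bar>"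
  proof (rule root_Arg_ge_of_nonneg_coeffs[OF assms(1) _ _ _ t root])
    show "card X \<le> n" if "X \<in> Pow {..<n}" for X
      using that card_mono[of "{..<n}" X] by simp
  qed (use w in auto)
  have real: "z \<in> complex_of_real ` {0..1}" if "t \<in> \<real>"
  proof (rule real_interval_if_one_minus_inverse_nonpos[OF z])
    show "1 - 1 / z \<in> \<real>"
      using that by (simp add: t_def)
    have "pi / n > 0"
      using assms(1) by simp
    then have "Arg t \<noteq> 0"
      using arg by auto
    then show "Re (1 - 1 / z) \<le> 0"
      using that by (auto simp: t_def Arg_eq_0)
  qed
  have "z \<in> eigenvalue_region n"
  proof (cases "n = 1")
    case True
    then have "Arg t = pi"
      using arg Arg_bounded[of t] by auto
    then have "t \<in> \<real>"
      by (simp add: Arg_eq_pi complex_is_Real_iff)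
    with real True show ?thesis
      by (simp add: eigenvalue_region_def)
  next
    case False
    then show ?thesis
      using assms(1) z t arg by (intro eigenvalue_region_if_Arg) (auto simp: t_def)
  qed
  with real show ?thesis
    by (auto simp: t_def)
qed

end
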